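(* Let $F$ be a non-archimedean local field of residue characteristic $p$ with residue field of cardinality $q=p^e$, let $G_S=\mathrm{SL}_2(F)$, $K_0=\mathrm{SL}_2(\mathcal{O}_F)$, let $\vec r\in\{0,\dots,p-1\}^e$, let $\tau$ be the standard Hecke operator on $\mathrm{ind}_{K_0}^{G_S}(\sigma_{\vec r})$, and let $C_{0,\sigma_{\vec r}}$, $C_{1,\sigma_{\vec r}}$ be the subspaces of $\mathrm{ind}_{K_0}^{G_S}(\sigma_{\vec r})$ defined in the context. Then the map $\tau:C_{0,\sigma_{\vec r}}\to C_{1,\sigma_{\vec r}}$ is injective.
   Context: $\bar{\mathbb{F}}_p$ is a fixed algebraic closure of $\mathbb{F}_p$; all representations are over $\bar{\mathbb{F}}_p$. $\mathcal{O}_F$ is the valuation ring of $F$, $\mathfrak{p}_F$ its maximal ideal, $\varpi_F$ a fixed uniformizer, $k_F=\mathcal{O}_F/\mathfrak{p}_F=\mathbb{F}_q$ with a fixed embedding in $\bar{\mathbb{F}}_p$, and $[\cdot]:k_F\to\mathcal{O}_F$ the Teichmüller lift. Weights: for $\vec r=(r_0,\dots,r_{e-1})\in\{0,\dots,p-1\}^e$, $\sigma_{\vec r}:=\mathrm{Sym}^{r_0}\bar{\mathbb{F}}_p^2\otimes\cdots\otimes\mathrm{Sym}^{r_{e-1}}\bar{\mathbb{F}}_p^2$, where $\mathrm{Sym}^{r_i}\bar{\mathbb{F}}_p^2=\bigoplus_{l=0}^{r_i}\bar{\mathbb{F}}_pX^{r_i-l}Y^l$ and $\begin{pmatrix}a&b\\c&d\end{pmatrix}\in\mathrm{SL}_2(\mathbb{F}_q)$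 acts on the $i$-th factor by $X^{r_i-l}Y^l\mapsto(a^{p^i}X+c^{p^i}Y)^{r_i-l}(b^{p^i}X+d^{p^i}Y)^l$; $K_0$ acts through reduction $K_0\to\mathrm{SL}_2(\mathbb{F}_q)$. Compact induction: $\mathrm{ind}_{K_0}^{G_S}(\sigma_{\vec r})$ is the space of functions $f:G_S\to\sigma_{\vec r}$ with $f(kg)=\sigma_{\vec r}(k)f(g)$ for $k\in K_0$, $g\in G_S$, and support a finite union of cosets $K_0g$; $G_S$ acts by $(g\cdot f)(g')=f(g'g)$. For $g\in G_S$, $v\in\sigma_{\vec r}$, the standard function $[g,v]$ is given by $[g,v](x)=\sigma_{\vec r}(xg)v$ if $x\in K_0g^{-1}$ and $0$ otherwise; these span the compact induction. Let $\alpha_0=\mathrm{diag}(\varpi_F^{-1},\varpi_F)$, $w_0=\begin{pmatrix}0&-1\\1&0\end{pmatrix}$, and $I_S(1)=\begin{pmatrix}1+\mathfrak{p}_F&\mathcal{O}_F\\\mathfrak{p}_F&1+\mathfrak{p}_F\end{pmatrix}\cap K_0$. For $\lambda=(\lambda_0,\dots,\lambda_{m-1})\in k_F^m$ put $A(\lambda)=\sum_{j=0}^{m-1}[\lambda_j]\varpi_F^j$. Let $U_{\vec r}=U_{r_0}\otimes\cdots\otimes U_{r_{e-1}}\in\mathrm{End}_{\bar{\mathbb{F}}_p}(\sigma_{\vec r})$, where $U_{r_j}(X^lY^{r_j-l})=Y^{r_j}$ if $l=0$ and $0$ if $l\ne0$. Hecke operator: $\tau$ is the $G_S$-equivariant endomorphism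 of $\mathrm{ind}_{K_0}^{G_S}(\sigma_{\vec r})$ (a generator of the polynomial algebra $\mathrm{End}_{G_S}(\mathrm{ind}_{K_0}^{G_S}(\sigma_{\vec r}))=\bar{\mathbb{F}}_p[\tau]$) given by $$\tau([g,v])=\sum_{\lambda\in k_F^2}\Big[g\begin{pmatrix}1&A(\lambda)\\0&1\end{pmatrix}\alpha_0^{-1},\,w_0U_{\vec r}\,\sigma_{\vec r}\Big(\begin{pmatrix}0&1\\-1&A(\lambda)\end{pmatrix}\Big)v\Big]+\sum_{\mu\in k_F}\Big[g\begin{pmatrix}1&0\\\varpi_FA(\mu)&1\end{pmatrix}\alpha_0,\,U_{\vec r}v\Big].$$ Subspaces: for $n\ge0$, $R_n^+(\sigma_{\vec r})$ (resp. $R_n^-(\sigma_{\vec r})$) is the subspace of functions in $\mathrm{ind}_{K_0}^{G_S}(\sigma_{\vec r})$ supported on $K_0\alpha_0^nI_S(1)$ (resp. $K_0\alpha_0^{-(n+1)}I_S(1)$). $C_{0,\sigma_{\vec r}}:=R_0^+(\sigma_{\vec r})$ and $C_{1,\sigma_{\vec r}}:=R_1^+(\sigma_{\vec r})\oplus R_0^-(\sigma_{\vec r})$. It is known that $\tau(C_{0,\sigma_{\vec r}})\subseteq C_{1,\sigma_{\vec r}}$. *)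

theory Defs
  imports
    "HOL-Analysis.Analysis"
    "HOL-Algebra.Algebraic_Closure_Type"
    "HOL-Library.Function_Algebras"
begin

section \<open>Non-archimedean local fields\<close>

text \<open>
  A field with a discrete valuation is a function \<open>v :: 'a \<Rightarrow> int\<close> on a field type. The value
  \<open>v 0\<close> is unspecified and plays the role of \<open>\<infinity>\<close>: every use of \<open>v\<close> is guarded by a test
  for zero.
\<close>

definition val_ring :: "('a::field \<Rightarrow> int) \<Rightarrow> 'a set" where
  "val_ring v = {x. x = 0 \<or> 0 \<le> v x}"

definition max_ideal :: "('a::field \<Rightarrow> int) \<Rightarrow> 'a set" where
  "max_ideal v = {x. x = 0 \<or> 0 < v x}"

definition integer_ring :: "('a::field \<Rightarrow> int) \<Rightarrow> 'a ring" where
  "integer_ring v = ring_of_type_algebra\<lparr>carrier := val_ring v\<rparr>"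

definition residue_field :: "('a::field \<Rightarrow> int) \<Rightarrow> 'a set ring" where
  "residue_field v = integer_ring v Quot max_ideal v"

definition val_close :: "('a::field \<Rightarrow> int) \<Rightarrow> int \<Rightarrow> 'a \<Rightarrow> 'a \<Rightarrow> bool" where
  "val_close v n x y \<longleftrightarrow> x - y = 0 \<or> n \<le> v (x - y)"

locale nonarch_local_field =
  fixes v :: "'a::field \<Rightarrow> int"
  assumes val_mult: "x \<noteq> 0 \<Longrightarrow> y \<noteq> 0 \<Longrightarrow> v (x * y) = v x + v y"
    and val_add: "x \<noteq> 0 \<Longrightarrow> y \<noteq> 0 \<Longrightarrow> x + y \<noteq> 0 \<Longrightarrow> min (v x) (v y) \<le> v (x + y)"
    and val_surj: "v ` (UNIV - {0}) = UNIV"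
    and val_complete:
      "(\<And>n. \<exists>N. \<forall>i\<ge>N. \<forall>j\<ge>N. val_close v n (s i) (s j)) \<Longrightarrow>
        \<exists>x. \<forall>n. \<exists>N::nat. \<forall>i\<ge>N. val_close v n (s i) x"
    and finite_residue_field: "finite (carrier (residue_field v))"


section \<open>Matrices\<close>

definition mat2 :: "'a::zero \<Rightarrow> 'a \<Rightarrow> 'a \<Rightarrow> 'a \<Rightarrow> 'a^2^2" where
  "mat2 a b c d = vector [vector [a, b], vector [c, d]]"

definition SL2 :: "('a::field^2^2) set" where
  "SL2 = {A. det A = 1}"

definition w0 :: "'a::field^2^2" where
  "w0 = mat2 0 (-1) 1 0"


section \<open>Weights, compact induction and the Hecke operator\<close>

text \<open>
  \<open>\<pi>\<close> is the fixed uniformizer, \<open>\<iota>\<close> the fixed embedding of the residue field into the algebraic closure \<open>'k\<close> of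
  \<open>\<F>\<^sub>p\<close> (the prime subfield \<open>range of_nat\<close>). Only the values \<open>r i\<close> with \<open>i < e\<close> matter.
\<close>

locale sl2_weight = nonarch_local_field v
  for v :: "'a::field \<Rightarrow> int" +
  fixes \<pi> :: 'a and \<iota> :: "'a set \<Rightarrow> 'k::field" and p e :: nat and r :: "nat \<Rightarrow> nat"
  assumes uniformizer: "\<pi> \<noteq> 0" "v \<pi> = 1"
    and prime_p: "Factorial_Ring.prime p"
    and card_residue_field: "card (carrier (residue_field v)) = p ^ e"
    and char_closure: "CHAR('k) = p"
    and alg_closure_Fp: "algebraic_closure (ring_of_type_algebra :: 'k ring) (range of_nat)"
    and embedding: "\<iota> \<in> ring_hom (residue_field v) (ring_of_type_algebra :: 'k ring)"
    and weight_range: "i < e \<Longrightarrow> r i \<le> p - 1"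
begin

definition K0 :: "('a^2^2) set" where
  "K0 = {A \<in> SL2. \<forall>i j. A $ i $ j \<in> val_ring v}"

definition IS1 :: "('a^2^2) set" where
  "IS1 = {A \<in> K0. A $ 1 $ 1 - 1 \<in> max_ideal v \<and> A $ 2 $ 1 \<in> max_ideal v
                 \<and> A $ 2 $ 2 - 1 \<in> max_ideal v}"

text \<open>The integer power \<open>\<alpha>\<^sub>0\<^sup>n\<close> of \<open>\<alpha>\<^sub>0 = diag(\<pi>\<^sup>-\<^sup>1, \<pi>)\<close>.\<close>

definition \<alpha>0_pow :: "int \<Rightarrow> 'a^2^2" where
  "\<alpha>0_pow n = mat2 (\<pi> powi (- n)) 0 0 (\<pi> powi n)"

text \<open>The unique element of the residue class \<open>c\<close> which is zero or a \<open>(q - 1)\<close>-st root of unity.\<close>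

definition teichmueller :: "'a set \<Rightarrow> 'a" where
  "teichmueller c = (THE t. t \<in> c \<and> t ^ card (carrier (residue_field v)) = t)"

definition residue_tuples :: "nat \<Rightarrow> (nat \<Rightarrow> 'a set) set" where
  "residue_tuples m = {..<m} \<rightarrow>\<^sub>E carrier (residue_field v)"

definition A :: "nat \<Rightarrow> (nat \<Rightarrow> 'a set) \<Rightarrow> 'a" where
  "A m \<xi> = (\<Sum>j<m. teichmueller (\<xi> j) * \<pi> ^ j)"


subsection \<open>The weight\<close>

text \<open>
  A multi-index \<open>l\<close> stands for the basis vector
  \<open>X\<^sup>r\<^sup>0\<^sup>-\<^sup>l\<^sup>0 Y\<^sup>l\<^sup>0 \<otimes> \<dots>\<close> of the tensor product, i.e. \<open>l i\<close> is the exponent of \<open>Y\<close> in the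
  \<open>i\<close>-th factor; an element of the tensor product is its family of coordinates, extended by
  zero outside the index set.
\<close>

definition weight_index :: "(nat \<Rightarrow> nat) set" where
  "weight_index = (\<Pi>\<^sub>E i\<in>{..<e}. {..r i})"

definition weight_space :: "((nat \<Rightarrow> nat) \<Rightarrow> 'k) set" where
  "weight_space = {x. \<forall>l. l \<notin> weight_index \<longrightarrow> x l = 0}"

text \<open>
  \<open>tensor_map T\<close> is the tensor product of the endomorphisms of the factors given by
  \<open>X\<^sup>r\<^sup>-\<^sup>l Y\<^sup>l \<mapsto> (\<Sum>m. T i l m X\<^sup>r\<^sup>-\<^sup>m Y\<^sup>m)\<close>, where \<open>r = r i\<close>.
\<close>

definition tensor_map ::
  "(nat \<Rightarrow> nat \<Rightarrow> nat \<Rightarrow> 'k) \<Rightarrow> ((nat \<Rightarrow> nat) \<Rightarrow> 'k) \<Rightarrow> ((nat \<Rightarrow> nat) \<Rightarrow> 'k)" where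
  "tensor_map T x = (\<lambda>m. if m \<in> weight_index
     then \<Sum>l\<in>weight_index. (\<Prod>i<e. T i (l i) (m i)) * x l else 0)"

text \<open>
  The coefficient of \<open>X\<^sup>s\<^sup>-\<^sup>m Y\<^sup>m\<close> in \<open>(a X + c Y)\<^sup>s\<^sup>-\<^sup>l (b X + d Y)\<^sup>l\<close>, computed after setting \<open>X = 1\<close>.
\<close>

definition sym_coeff :: "nat \<Rightarrow> 'k^2^2 \<Rightarrow> nat \<Rightarrow> nat \<Rightarrow> 'k" where
  "sym_coeff s M l m =
     poly.coeff ([:M $ 1 $ 1, M $ 2 $ 1:] ^ (s - l) * [:M $ 1 $ 2, M $ 2 $ 2:] ^ l) m"

definition reduction :: "'a \<Rightarrow> 'k" where
  "reduction x = \<iota> (max_ideal v +>\<^bsub>integer_ring v\<^esub> x)"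

definition \<sigma> :: "'a^2^2 \<Rightarrow> ((nat \<Rightarrow> nat) \<Rightarrow> 'k) \<Rightarrow> ((nat \<Rightarrow> nat) \<Rightarrow> 'k)" where
  "\<sigma> k = tensor_map (\<lambda>i. sym_coeff (r i) (\<chi> a b. reduction (k $ a $ b) ^ (p ^ i)))"

definition U :: "((nat \<Rightarrow> nat) \<Rightarrow> 'k) \<Rightarrow> ((nat \<Rightarrow> nat) \<Rightarrow> 'k)" where
  "U = tensor_map (\<lambda>i l m. if l = r i \<and> m = r i then 1 else 0)"


subsection \<open>The compact induction\<close>

text \<open>
  Functions on \<open>SL2\<close> are extended by zero to all matrices, so that equality of functions
  is equality on \<open>SL2\<close>.
\<close>

definition ind :: "('a^2^2 \<Rightarrow> (nat \<Rightarrow> nat) \<Rightarrow> 'k) set" where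
  "ind = {f. (\<forall>g. g \<notin> SL2 \<longrightarrow> f g = 0)
           \<and> (\<forall>g\<in>SL2. f g \<in> weight_space)
           \<and> (\<forall>k\<in>K0. \<forall>g\<in>SL2. f (k ** g) = \<sigma> k (f g))
           \<and> (\<exists>S. finite S \<and> S \<subseteq> SL2 \<and> {g. f g \<noteq> 0} = (\<Union>g\<in>S. (\<lambda>k. k ** g) ` K0))}"

definition translate ::
  "'a^2^2 \<Rightarrow> ('a^2^2 \<Rightarrow> (nat \<Rightarrow> nat) \<Rightarrow> 'k) \<Rightarrow> ('a^2^2 \<Rightarrow> (nat \<Rightarrow> nat) \<Rightarrow> 'k)" where
  "translate g f = (\<lambda>x. f (x ** g))"

definition scale ::
  "'k \<Rightarrow> ('a^2^2 \<Rightarrow> (nat \<Rightarrow> nat) \<Rightarrow> 'k) \<Rightarrow> ('a^2^2 \<Rightarrow> (nat \<Rightarrow> nat) \<Rightarrow> 'k)" where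
  "scale c f = (\<lambda>x l. c * f x l)"

definition std_fun :: "'a^2^2 \<Rightarrow> ((nat \<Rightarrow> nat) \<Rightarrow> 'k) \<Rightarrow> ('a^2^2 \<Rightarrow> (nat \<Rightarrow> nat) \<Rightarrow> 'k)" where
  "std_fun g y = (\<lambda>x. if x \<in> (\<lambda>k. k ** matrix_inv g) ` K0 then \<sigma> (x ** g) y else 0)"

definition hecke_operator ::
  "(('a^2^2 \<Rightarrow> (nat \<Rightarrow> nat) \<Rightarrow> 'k) \<Rightarrow> ('a^2^2 \<Rightarrow> (nat \<Rightarrow> nat) \<Rightarrow> 'k)) \<Rightarrow> bool" where
  "hecke_operator \<tau> \<longleftrightarrow>
     (\<forall>f\<in>ind. \<tau> f \<in> ind)
   \<and> (\<forall>f\<in>ind. \<forall>h\<in>ind. \<tau> (f + h) = \<tau> f + \<tau> h)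
   \<and> (\<forall>c. \<forall>f\<in>ind. \<tau> (scale c f) = scale c (\<tau> f))
   \<and> (\<forall>g\<in>SL2. \<forall>f\<in>ind. \<tau> (translate g f) = translate g (\<tau> f))
   \<and> (\<forall>g\<in>SL2. \<forall>y\<in>weight_space. \<tau> (std_fun g y) =
        (\<Sum>\<xi>\<in>residue_tuples 2.
           std_fun (g ** mat2 1 (A 2 \<xi>) 0 1 ** \<alpha>0_pow (- 1))
                   (\<sigma> w0 (U (\<sigma> (mat2 0 1 (- 1) (A 2 \<xi>)) y))))
      + (\<Sum>\<mu>\<in>residue_tuples 1.
           std_fun (g ** mat2 1 0 (\<pi> * A 1 \<mu>) 1 ** \<alpha>0_pow 1) (U y)))"

definition double_coset :: "int \<Rightarrow> ('a^2^2) set" where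
  "double_coset n = {k ** \<alpha>0_pow n ** i | k i. k \<in> K0 \<and> i \<in> IS1}"

definition R_plus :: "nat \<Rightarrow> ('a^2^2 \<Rightarrow> (nat \<Rightarrow> nat) \<Rightarrow> 'k) set" where
  "R_plus n = {f \<in> ind. {g. f g \<noteq> 0} \<subseteq> double_coset (int n)}"

definition R_minus :: "nat \<Rightarrow> ('a^2^2 \<Rightarrow> (nat \<Rightarrow> nat) \<Rightarrow> 'k) set" where
  "R_minus n = {f \<in> ind. {g. f g \<noteq> 0} \<subseteq> double_coset (- (int n + 1))}"

definition C0 :: "('a^2^2 \<Rightarrow> (nat \<Rightarrow> nat) \<Rightarrow> 'k) set" where
  "C0 = R_plus 0"

text \<open>The sum is direct, since the two double cosets are disjoint.\<close>

definition C1 :: "('a^2^2 \<Rightarrow> (nat \<Rightarrow> nat) \<Rightarrow> 'k) set" where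
  "C1 = {f + h | f h. f \<in> R_plus 1 \<and> h \<in> R_minus 0}"

end

end

theory Submission
  imports Defs
begin

text \<open>
  A function in \<open>C0\<close> is supported on \<open>K0\<close>, so it is the standard function \<open>[1, y]\<close> with \<open>y\<close> its value at the
  identity. The Hecke operator sends \<open>[1, y]\<close> to a sum over \<open>\<xi>\<close> of standard functions supported on the
  cosets \<open>K0 \<alpha>\<^sub>0 u(- A \<xi>)\<close>, where \<open>u\<close> denotes upper unipotent matrices, plus a sum of standard functions
  supported on cosets \<open>K0 \<alpha>\<^sub>0\<^sup>-\<^sup>1 l\<close> with \<open>l\<close> lower unipotent and congruent to 1. These unipotent
  matrices lie in \<open>IS1\<close>, so the two sums live on the double cosets that define \<open>C1\<close>. Since the
  double cosets are stable under \<open>K0\<close>, restricting \<open>\<tau> f\<close> to one of them and to its complement gives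
  the required decomposition (\<open>hecke_image_in_C1\<close>).

  For injectivity, each of the first cosets is disjoint from all the others that occur
  (\<open>test_point_upper_rep_in_K0_iff\<close>, \<open>test_point_lower_rep_notin_K0\<close>). Hence the value of \<open>\<tau> [1, y]\<close>
  at \<open>\<alpha>\<^sub>0 u(- A \<xi>)\<close> is the single vector obtained from \<open>y\<close> by applying the matrix with rows
  \<open>(0, 1)\<close> and \<open>(-1, A \<xi>)\<close>, then \<open>U\<close>, then \<open>w0\<close>. The operator \<open>U\<close> keeps only the coefficient of the
  highest power of \<open>Y\<close>. The matrix maps \<open>X\<close> to \<open>-Y\<close> and \<open>Y\<close> to \<open>X + \<lambda> Y\<close> with \<open>\<lambda>\<close> the reduction of \<open>A \<xi>\<close>, so
  this coefficient is \<open>\<Sum>l. \<plusminus> y l * \<lambda>\<close> to the power \<open>\<Sum>i. l i * p\<^sup>i\<close> (\<open>\<sigma>_twist_top\<close>). As \<open>\<lambda>\<close> runs through the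
  residue field, this is a polynomial function on \<open>q\<close> points whose exponents are pairwise distinct and
  at most \<open>q - 1\<close>, because \<open>l i \<le> p - 1\<close> makes them base \<open>p\<close> expansions with \<open>e\<close> digits. So its values
  determine all coordinates \<open>y l\<close> (\<open>twist_top_injective\<close>).

  The elements \<open>A \<xi>\<close> are built from Teichmueller representatives. Their existence comes from
  completeness: the map \<open>x \<mapsto> x\<^sup>q\<close> is contracting on every residue class, and the representative
  is its fixed point there (\<open>teichmueller\<close>).
\<close>


section \<open>Powers of the maximal ideal\<close>

context nonarch_local_field
begin

text \<open>
  The guarded form of \<open>n \<le> v x\<close>: with it the ring of integers, its maximal ideal and closeness
  of two elements are instances of one family, for which the two laws of the valuation
  hold without a case distinction at zero.
\<close>

definition ideal_power :: "int \<Rightarrow> 'a set" where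
  "ideal_power n = {x. x = 0 \<or> n \<le> v x}"

lemma val_ring_eq: "val_ring v = ideal_power 0"
  by (simp add: val_ring_def ideal_power_def)

lemma max_ideal_eq: "max_ideal v = ideal_power 1"
  by (auto simp: max_ideal_def ideal_power_def)

lemma val_close_iff: "val_close v n x y \<longleftrightarrow> x - y \<in> ideal_power n"
  by (simp add: val_close_def ideal_power_def)

lemma val_one: "v 1 = 0"
  using val_mult[of 1 1] by simp

lemma val_minus_one: "v (- 1) = 0"
  using val_mult[of "- 1" "- 1"] val_one by simp

lemma val_inverse: "x \<noteq> 0 \<Longrightarrow> v (inverse x) = - v x"
  using val_mult[of x "inverse x"] val_one by simp

lemma ideal_power_zero [simp]: "0 \<in> ideal_power n"
  by (simp add: ideal_power_def)

lemma ideal_power_nonempty [simp]: "ideal_power n \<noteq> {}"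
  using ideal_power_zero by blast

lemma ideal_power_add: "x \<in> ideal_power n \<Longrightarrow> y \<in> ideal_power n \<Longrightarrow> x + y \<in> ideal_power n"
  unfolding ideal_power_def using val_add[of x y]
  by (cases "x = 0"; cases "y = 0"; cases "x + y = 0") auto

lemma ideal_power_mult:
  "x \<in> ideal_power m \<Longrightarrow> y \<in> ideal_power n \<Longrightarrow> x * y \<in> ideal_power (m + n)"
  unfolding ideal_power_def using val_mult[of x y] by (cases "x = 0"; cases "y = 0") auto

lemma ideal_power_minus: "x \<in> ideal_power n \<Longrightarrow> - x \<in> ideal_power n"
  using ideal_power_mult[of "- 1" 0 x n] by (simp add: ideal_power_def val_minus_one)

lemma ideal_power_diff: "x \<in> ideal_power n \<Longrightarrow> y \<in> ideal_power n \<Longrightarrow> x - y \<in> ideal_power n"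
  using ideal_power_add[of x n "- y"] ideal_power_minus[of y n] by simp

lemma ideal_power_diff_commute: "x - y \<in> ideal_power n \<Longrightarrow> y - x \<in> ideal_power n"
  using ideal_power_minus[of "x - y" n] by simp

lemma ideal_power_diff_trans:
  "x - y \<in> ideal_power n \<Longrightarrow> y - z \<in> ideal_power n \<Longrightarrow> x - z \<in> ideal_power n"
  using ideal_power_add[of "x - y" n "y - z"] by simp

lemma ideal_power_mono: "m \<le> n \<Longrightarrow> x \<in> ideal_power n \<Longrightarrow> x \<in> ideal_power m"
  by (auto simp: ideal_power_def)

lemma ideal_power_Inter_zero:
  assumes "\<And>n::nat. x \<in> ideal_power (int n)"
  shows "x = 0"
  using assms[of "nat (v x + 1)"] by (auto simp: ideal_power_def split: if_splits)

lemma val_ring_zero [simp]: "0 \<in> val_ring v"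
  and val_ring_one [simp]: "1 \<in> val_ring v"
  by (simp_all add: val_ring_def val_one)

lemma val_ring_add: "x \<in> val_ring v \<Longrightarrow> y \<in> val_ring v \<Longrightarrow> x + y \<in> val_ring v"
  and val_ring_mult: "x \<in> val_ring v \<Longrightarrow> y \<in> val_ring v \<Longrightarrow> x * y \<in> val_ring v"
  and val_ring_minus: "x \<in> val_ring v \<Longrightarrow> - x \<in> val_ring v"
  and val_ring_diff: "x \<in> val_ring v \<Longrightarrow> y \<in> val_ring v \<Longrightarrow> x - y \<in> val_ring v"
  unfolding val_ring_eq using ideal_power_mult[of x 0 y 0]
  by (simp_all add: ideal_power_add ideal_power_minus ideal_power_diff)

lemma val_ring_power: "x \<in> val_ring v \<Longrightarrow> x ^ n \<in> val_ring v"
  by (induction n) (simp_all add: val_ring_mult)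

lemma val_ring_sum: "(\<And>i. i \<in> I \<Longrightarrow> f i \<in> val_ring v) \<Longrightarrow> (\<Sum>i\<in>I. f i) \<in> val_ring v"
  by (induction I rule: infinite_finite_induct) (simp_all add: val_ring_add)

lemma max_ideal_imp_val_ring: "x \<in> max_ideal v \<Longrightarrow> x \<in> val_ring v"
  by (auto simp: max_ideal_def val_ring_def)

lemma integer_ring_simps:
  "carrier (integer_ring v) = val_ring v"
  "x \<otimes>\<^bsub>integer_ring v\<^esub> y = x * y"
  "x \<oplus>\<^bsub>integer_ring v\<^esub> y = x + y"
  "\<zero>\<^bsub>integer_ring v\<^esub> = 0"
  "\<one>\<^bsub>integer_ring v\<^esub> = 1"
  by (simp_all add: integer_ring_def ring_of_type_algebra_def)

lemma cring_integer_ring: "cring (integer_ring v)"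
proof (rule cringI)
  show "abelian_group (integer_ring v)"
    by (rule abelian_groupI)
       (auto simp: integer_ring_simps val_ring_add algebra_simps
             intro!: bexI[of _ "- _"] val_ring_minus)
  show "Group.comm_monoid (integer_ring v)"
    by unfold_locales (auto simp: integer_ring_simps val_ring_mult algebra_simps)
qed (auto simp: integer_ring_simps algebra_simps)

lemma ideal_max_ideal: "ideal (max_ideal v) (integer_ring v)"
proof -
  interpret R: cring "integer_ring v" by (rule cring_integer_ring)
  have a_inv: "\<ominus>\<^bsub>integer_ring v\<^esub> x = - x" if "x \<in> val_ring v" for x
    using R.minus_equality[of "- x" x] that by (simp add: integer_ring_simps val_ring_minus)
  show ?thesis
  proof (rule idealI)
    show "subgroup (max_ideal v) (add_monoid (integer_ring v))"
      using a_inv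
      by (intro R.add.subgroupI)
         (auto simp: integer_ring_simps max_ideal_imp_val_ring max_ideal_eq ideal_power_add
               ideal_power_minus a_inv_def[symmetric])
  qed (use R.ring_axioms ideal_power_mult[of _ 0 _ 1] ideal_power_mult[of _ 1 _ 0] in
       \<open>auto simp: integer_ring_simps max_ideal_eq val_ring_eq\<close>)
qed

lemma residue_class_eq: "max_ideal v +>\<^bsub>integer_ring v\<^esub> x = {y. y - x \<in> max_ideal v}"
  by (auto simp: a_r_coset_def' integer_ring_simps intro!: bexI[of _ "_ - x"])

lemma carrier_residue_field:
  "carrier (residue_field v) = (\<lambda>x. max_ideal v +>\<^bsub>integer_ring v\<^esub> x) ` val_ring v"
  by (auto simp: residue_field_def FactRing_def A_RCOSETS_def' integer_ring_simps)

end

section \<open>The reduction map\<close>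

lemma ring_of_type_algebra_simps:
  "carrier (ring_of_type_algebra :: 'b::comm_ring_1 ring) = UNIV"
  "x \<otimes>\<^bsub>ring_of_type_algebra\<^esub> (y :: 'b) = x * y"
  "x \<oplus>\<^bsub>ring_of_type_algebra\<^esub> (y :: 'b) = x + y"
  "\<one>\<^bsub>(ring_of_type_algebra :: 'b ring)\<^esub> = 1"
  by (simp_all add: ring_of_type_algebra_def)

context sl2_weight
begin

lemma reduction_ring_hom:
  "reduction \<in> ring_hom (integer_ring v) (ring_of_type_algebra :: 'k ring)"
proof -
  have "\<iota> \<circ> (\<lambda>x. max_ideal v +>\<^bsub>integer_ring v\<^esub> x) \<in> ring_hom (integer_ring v) ring_of_type_algebra"
    using ring_hom_trans[OF ideal.rcos_ring_hom[OF ideal_max_ideal]] embedding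
    by (simp add: residue_field_def)
  moreover have "reduction = \<iota> \<circ> (\<lambda>x. max_ideal v +>\<^bsub>integer_ring v\<^esub> x)"
    by (auto simp: reduction_def)
  ultimately show ?thesis by simp
qed

lemma reduction_add:
  "x \<in> val_ring v \<Longrightarrow> y \<in> val_ring v \<Longrightarrow> reduction (x + y) = reduction x + reduction y"
  using ring_hom_add[OF reduction_ring_hom, of x y]
  by (simp add: integer_ring_simps ring_of_type_algebra_simps)

lemma reduction_mult:
  "x \<in> val_ring v \<Longrightarrow> y \<in> val_ring v \<Longrightarrow> reduction (x * y) = reduction x * reduction y"
  using ring_hom_mult[OF reduction_ring_hom, of x y]
  by (simp add: integer_ring_simps ring_of_type_algebra_simps)

lemma reduction_one [simp]: "reduction 1 = 1"
  using ring_hom_one[OF reduction_ring_hom]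
  by (simp add: integer_ring_simps ring_of_type_algebra_simps)

lemma reduction_zero [simp]: "reduction 0 = 0"
proof -
  have "reduction 0 + reduction 0 = reduction 0 + 0" using reduction_add[of 0 0] by simp
  then show ?thesis by (simp only: add_left_cancel)
qed

lemma reduction_diff:
  "x \<in> val_ring v \<Longrightarrow> y \<in> val_ring v \<Longrightarrow> reduction (x - y) = reduction x - reduction y"
  using reduction_add[of "x - y" y] by (simp add: val_ring_diff)

lemma reduction_minus: "x \<in> val_ring v \<Longrightarrow> reduction (- x) = - reduction x"
  using reduction_diff[of 0 x] by simp

lemma reduction_power: "x \<in> val_ring v \<Longrightarrow> reduction (x ^ n) = reduction x ^ n"
  by (induction n) (simp_all add: reduction_mult val_ring_power)

lemma reduction_sum:
  "(\<And>i. i \<in> I \<Longrightarrow> f i \<in> val_ring v) \<Longrightarrow> reduction (\<Sum>i\<in>I. f i) = (\<Sum>i\<in>I. reduction (f i))"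
  by (induction I rule: infinite_finite_induct) (simp_all add: reduction_add val_ring_sum)

text \<open>
  An integer outside the maximal ideal is a unit, and a unit has nonzero image under any ring
  homomorphism to a field.
\<close>

lemma reduction_eq_0_iff:
  assumes "x \<in> val_ring v"
  shows "reduction x = 0 \<longleftrightarrow> x \<in> max_ideal v"
proof
  assume "x \<in> max_ideal v"
  then have "max_ideal v +>\<^bsub>integer_ring v\<^esub> x = max_ideal v +>\<^bsub>integer_ring v\<^esub> 0"
    using ideal_power_add[of "_ - x" 1 x] ideal_power_diff[of _ 1 x]
    unfolding residue_class_eq by (auto simp: max_ideal_eq)
  then have "reduction x = reduction 0" by (simp only: reduction_def)
  then show "reduction x = 0" by simp
next
  assume 0: "reduction x = 0"
  show "x \<in> max_ideal v"
  proof (rule ccontr)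
    assume "x \<notin> max_ideal v"
    with assms have "x \<noteq> 0" "v x = 0" by (auto simp: max_ideal_def val_ring_def)
    then have "inverse x \<in> val_ring v" by (simp add: val_ring_def val_inverse)
    with assms have "reduction (x * inverse x) = 0" by (simp add: reduction_mult 0)
    with \<open>x \<noteq> 0\<close> show False by simp
  qed
qed

lemma reduction_eq_iff:
  "x \<in> val_ring v \<Longrightarrow> y \<in> val_ring v \<Longrightarrow> reduction x = reduction y \<longleftrightarrow> x - y \<in> max_ideal v"
  using reduction_eq_0_iff[of "x - y"] by (simp add: val_ring_diff reduction_diff)

lemma mem_residue_class_iff:
  assumes "c \<in> carrier (residue_field v)"
  shows "x \<in> c \<longleftrightarrow> x \<in> val_ring v \<and> reduction x = \<iota> c"
proof -
  obtain y where y: "y \<in> val_ring v" "c = max_ideal v +>\<^bsub>integer_ring v\<^esub> y"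
    using assms unfolding carrier_residue_field by blast
  then have "x \<in> c \<longleftrightarrow> x - y \<in> max_ideal v" "\<iota> c = reduction y"
    by (simp_all add: residue_class_eq reduction_def)
  moreover have "x \<in> val_ring v" if "x - y \<in> max_ideal v"
    using val_ring_add[OF max_ideal_imp_val_ring[OF that] y(1)] by simp
  ultimately show ?thesis using reduction_eq_iff[of x y] y(1) by auto
qed

lemma residue_class_ex: "c \<in> carrier (residue_field v) \<Longrightarrow> \<exists>x\<in>val_ring v. reduction x = \<iota> c"
  unfolding carrier_residue_field by (auto simp: reduction_def)

lemma embedding_inj: "inj_on \<iota> (carrier (residue_field v))"
  by (intro inj_onI Set.set_eqI) (simp add: mem_residue_class_iff)

text \<open>
  The residue field, as the subfield of \<open>'k\<close> with \<open>q = p\<^sup>e\<close> elements.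
\<close>

definition residue_image :: "'k set" where
  "residue_image = reduction ` val_ring v"

lemma residue_image_eq: "residue_image = \<iota> ` carrier (residue_field v)"
  by (simp add: residue_image_def carrier_residue_field image_image reduction_def)

lemma finite_residue_image: "finite residue_image"
  by (simp add: residue_image_eq finite_residue_field)

lemma card_residue_image: "card residue_image = p ^ e"
  by (simp add: residue_image_eq card_image[OF embedding_inj] card_residue_field)

lemma e_pos: "e > 0"
proof (rule ccontr)
  assume "\<not> e > 0"
  then have "card residue_image = 1" by (simp add: card_residue_image)
  moreover have "reduction 0 \<in> residue_image" "reduction 1 \<in> residue_image"
    by (simp_all only: residue_image_def imageI val_ring_zero val_ring_one)
  ultimately show False by (auto simp: card_1_singleton_iff)
qed

lemma of_nat_residue_card: "(of_nat (p ^ e) :: 'k) = 0"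
proof -
  have "(of_nat p :: 'k) = 0"
    using char_closure of_nat_CHAR[where ?'a = 'k] by simp
  with e_pos show ?thesis by (simp add: of_nat_power)
qed

text \<open>
  Fermat's little theorem for the residue field: multiplication by a nonzero element permutes
  the nonzero elements, so it leaves their product unchanged.
\<close>

lemma residue_image_power_card:
  assumes "a \<in> residue_image"
  shows "a ^ (p ^ e) = a"
proof (cases "a = 0")
  case True
  then show ?thesis using prime_p by (simp add: prime_gt_0_nat)
next
  case False
  let ?S = "residue_image - {0}"
  have fin: "finite ?S" using finite_residue_image by simp
  have inj: "inj_on ((*) a) ?S" using False by (auto intro: inj_onI)
  have "(*) a ` ?S \<subseteq> ?S"
  proof -
    have "a * b \<in> residue_image" if "b \<in> residue_image" for b
    proof -
      obtain x y where "x \<in> val_ring v" "y \<in> val_ring v" "a = reduction x" "b = reduction y"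
        using assms \<open>b \<in> residue_image\<close> unfolding residue_image_def by blast
      then have "a * b = reduction (x * y)" "x * y \<in> val_ring v"
        by (simp_all add: reduction_mult val_ring_mult)
      then show ?thesis unfolding residue_image_def by blast
    qed
    with False show ?thesis by auto
  qed
  then have perm: "(*) a ` ?S = ?S" by (rule endo_inj_surj[OF fin _ inj])
  have "\<Prod>?S = prod id ((*) a ` ?S)" by (simp add: perm)
  also have "\<dots> = a ^ card ?S * \<Prod>?S" by (simp add: prod.reindex[OF inj] prod.distrib)
  finally have "a ^ card ?S = 1" using fin by simp
  moreover have "0 \<in> residue_image"
    using imageI[OF val_ring_zero, of reduction] by (simp add: residue_image_def)
  then have "card residue_image = Suc (card ?S)"
    using card.remove[OF finite_residue_image, of 0] by simp
  ultimately have "a ^ card residue_image = a" by simp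
  then show ?thesis by (simp add: card_residue_image)
qed


section \<open>Teichmueller representatives\<close>

text \<open>
  In \<open>x\<^sup>q - y\<^sup>q = (x - y) (x\<^sup>q\<^sup>-\<^sup>1 + x\<^sup>q\<^sup>-\<^sup>2 y + \<dots> + y\<^sup>q\<^sup>-\<^sup>1)\<close> the second factor reduces to
  \<open>q\<close> times a power of the common reduction of \<open>x\<close> and \<open>y\<close>, that is, to zero. So the \<open>q\<close>-th power map contracts
  every residue class, and the Teichmueller representative is its unique fixed point.
\<close>

lemma power_card_contracting:
  assumes "x \<in> val_ring v" "y \<in> val_ring v" "x - y \<in> ideal_power (int (Suc n))"
  shows "x ^ (p ^ e) - y ^ (p ^ e) \<in> ideal_power (int (Suc (Suc n)))"
proof -
  define S where "S = (\<Sum>i<p ^ e. y ^ (p ^ e - Suc i) * x ^ i)"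
  have "x - y \<in> max_ideal v"
    using assms(3) ideal_power_mono[of 1 "int (Suc n)"] by (simp add: max_ideal_eq)
  then have red: "reduction x = reduction y" by (simp add: reduction_eq_iff assms)
  have S: "S \<in> val_ring v"
    unfolding S_def by (intro val_ring_sum val_ring_mult val_ring_power assms)
  have "reduction S = (\<Sum>i<p ^ e. reduction y ^ (p ^ e - Suc i) * reduction y ^ i)"
    unfolding S_def
    by (simp add: reduction_sum reduction_mult reduction_power val_ring_mult val_ring_power
        assms red)
  also have "\<dots> = (\<Sum>i<p ^ e. reduction y ^ (p ^ e - 1))"
    by (intro sum.cong) (simp_all flip: power_add)
  also have "\<dots> = 0" using of_nat_residue_card by simp
  finally have "S \<in> ideal_power 1" using S by (simp add: reduction_eq_0_iff max_ideal_eq)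
  then have "(x - y) * S \<in> ideal_power (int (Suc n) + 1)"
    by (rule ideal_power_mult[OF assms(3)])
  then show ?thesis by (simp add: S_def power_diff_sumr2 add.commute)
qed

lemma ex_power_card_fixed_point:
  assumes "a \<in> val_ring v"
  shows "\<exists>t\<in>val_ring v. t ^ (p ^ e) = t \<and> reduction t = reduction a"
proof -
  \<comment> \<open>the orbit of \<open>a\<close> under the contracting map \<open>x \<mapsto> x\<^sup>q\<close>, whose limit is the fixed point\<close>
  define s where "s n = a ^ ((p ^ e) ^ n)" for n :: nat
  have s_Suc: "s (Suc n) = s n ^ (p ^ e)" for n
    by (simp add: s_def mult.commute flip: power_mult)
  have s_ring: "s n \<in> val_ring v" for n
    by (simp add: s_def val_ring_power assms)
  have step: "s (Suc n) - s n \<in> ideal_power (int (Suc n))" for n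
  proof (induction n)
    case 0
    have "reduction (s 1) = reduction (s 0)"
      using residue_image_power_card[of "reduction a"] assms
      by (simp add: s_def reduction_power residue_image_def)
    then show ?case by (simp add: reduction_eq_iff s_ring max_ideal_eq)
  next
    case (Suc n)
    show ?case using power_card_contracting[OF s_ring s_ring Suc] by (simp only: s_Suc)
  qed
  have far: "s (N + i) - s N \<in> ideal_power (int (Suc N))" for N i
  proof (induction i)
    case (Suc i)
    have "s (Suc (N + i)) - s (N + i) \<in> ideal_power (int (Suc N))"
      using ideal_power_mono[OF _ step[of "N + i"]] by simp
    with Suc show ?case using ideal_power_diff_trans by fastforce
  qed simp
  have cauchy: "\<exists>N. \<forall>i\<ge>N. \<forall>j\<ge>N. val_close v n (s i) (s j)" for n
  proof (intro exI allI impI)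
    fix i j assume "nat n \<le> i" "nat n \<le> j"
    then have "s i - s (nat n) \<in> ideal_power (int (Suc (nat n)))"
      "s j - s (nat n) \<in> ideal_power (int (Suc (nat n)))"
      using far[of "nat n" "i - nat n"] far[of "nat n" "j - nat n"] by simp_all
    then have "s i - s j \<in> ideal_power (int (Suc (nat n)))"
      using ideal_power_diff_trans ideal_power_diff_commute by blast
    then show "val_close v n (s i) (s j)"
      unfolding val_close_iff by (rule ideal_power_mono[rotated]) simp
  qed
  obtain t where t: "\<And>n. \<exists>N::nat. \<forall>i\<ge>N. s i - t \<in> ideal_power n"
    using val_complete[OF cauchy] unfolding val_close_iff by blast
  obtain N where N: "s N - t \<in> ideal_power 1" using t[of 1] by blast
  have "s N - (s N - t) \<in> val_ring v"
    by (intro val_ring_diff s_ring max_ideal_imp_val_ring) (simp add: max_ideal_eq N)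
  then have t_ring: "t \<in> val_ring v" by simp
  have "reduction t = reduction (s N)"
    using N ideal_power_diff_commute by (simp add: reduction_eq_iff t_ring s_ring max_ideal_eq)
  also have "s N - s 0 \<in> ideal_power 1" using far[of 0 N] by simp
  then have "reduction (s N) = reduction (s 0)"
    by (simp add: reduction_eq_iff s_ring max_ideal_eq)
  finally have red: "reduction t = reduction a" by (simp add: s_def)
  have "t ^ (p ^ e) - t \<in> ideal_power (int n)" for n
  proof -
    obtain M where M: "\<And>i. i \<ge> M \<Longrightarrow> s i - t \<in> ideal_power (int (Suc n))"
      using t[of "int (Suc n)"] by blast
    have "s M ^ (p ^ e) - t ^ (p ^ e) \<in> ideal_power (int (Suc (Suc n)))"
      using power_card_contracting[OF s_ring t_ring] M by blast
    then have "t ^ (p ^ e) - s (Suc M) \<in> ideal_power (int (Suc (Suc n)))"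
      unfolding s_Suc by (rule ideal_power_diff_commute)
    then have "t ^ (p ^ e) - s (Suc M) \<in> ideal_power (int n)"
      by (rule ideal_power_mono[rotated]) simp
    moreover have "s (Suc M) - t \<in> ideal_power (int n)"
      using ideal_power_mono[OF _ M[of "Suc M"], of "int n"] by simp
    ultimately show ?thesis by (rule ideal_power_diff_trans)
  qed
  then have "t ^ (p ^ e) - t = 0" by (rule ideal_power_Inter_zero)
  with t_ring red show ?thesis by auto
qed

lemma power_card_fixed_point_unique:
  assumes t: "t \<in> val_ring v" "t ^ (p ^ e) = t" and s: "s \<in> val_ring v" "s ^ (p ^ e) = s"
    and red: "reduction t = reduction s"
  shows "t = s"
proof -
  have close: "t - s \<in> ideal_power (int (Suc n))" for n
  proof (induction n)
    case 0
    show ?case using red by (simp add: reduction_eq_iff t s max_ideal_eq)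
  next
    case (Suc n)
    then show ?case using power_card_contracting[OF t(1) s(1)] by (simp only: t s)
  qed
  have "t - s \<in> ideal_power (int n)" for n
    by (rule ideal_power_mono[OF _ close[of n]]) simp
  then have "t - s = 0" by (rule ideal_power_Inter_zero)
  then show ?thesis by simp
qed

lemma teichmueller:
  assumes "c \<in> carrier (residue_field v)"
  shows "teichmueller c \<in> val_ring v" "reduction (teichmueller c) = \<iota> c"
proof -
  let ?P = "\<lambda>t. t \<in> c \<and> t ^ card (carrier (residue_field v)) = t"
  have P_iff: "?P t \<longleftrightarrow> t \<in> val_ring v \<and> reduction t = \<iota> c \<and> t ^ (p ^ e) = t" for t
    using mem_residue_class_iff[OF assms] by (simp add: card_residue_field)
  obtain a where "a \<in> val_ring v" "reduction a = \<iota> c"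
    using residue_class_ex[OF assms] by blast
  then obtain t where "?P t" using ex_power_card_fixed_point[of a] P_iff by auto
  then have "\<exists>!t. ?P t" using P_iff power_card_fixed_point_unique by (intro ex1I[of _ t]) auto
  then have "?P (teichmueller c)" unfolding teichmueller_def by (rule theI')
  then show "teichmueller c \<in> val_ring v" "reduction (teichmueller c) = \<iota> c"
    using P_iff by blast+
qed

end


section \<open>Determinant one matrices of size two\<close>

lemma mat2_nth [simp]:
  "mat2 a b c d $ 1 $ 1 = a" "mat2 a b c d $ 1 $ 2 = b"
  "mat2 a b c d $ 2 $ 1 = c" "mat2 a b c d $ 2 $ 2 = d"
  by (simp_all add: mat2_def)

lemma mat2_eqI:
  fixes M :: "'b::zero^2^2"
  assumes "M $ 1 $ 1 = a" "M $ 1 $ 2 = b" "M $ 2 $ 1 = c" "M $ 2 $ 2 = d"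
  shows "M = mat2 a b c d"
  using assms by (simp add: vec_eq_iff forall_2)

lemma mat2_mult:
  fixes a :: "'b::semiring_1"
  shows "mat2 a b c d ** mat2 a' b' c' d' =
    mat2 (a * a' + b * c') (a * b' + b * d') (c * a' + d * c') (c * b' + d * d')"
  by (rule mat2_eqI) (simp_all add: matrix_matrix_mult_def sum_2)

lemma mat_1_eq_mat2: "mat 1 = mat2 1 0 0 (1 :: 'b::semiring_1)"
  by (rule mat2_eqI) (simp_all add: mat_def)

lemma det_mat2: "det (mat2 a b c (d :: 'b::field)) = a * d - b * c"
  by (simp add: det_2)

lemma SL2_mult: "g \<in> SL2 \<Longrightarrow> h \<in> SL2 \<Longrightarrow> g ** h \<in> SL2"
  by (simp add: SL2_def det_mul)

lemma mat_1_in_SL2: "mat 1 \<in> SL2"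
  by (simp add: SL2_def)

lemma mat2_cases:
  fixes M :: "'b::zero^2^2"
  obtains a b c d where "M = mat2 a b c d"
  using mat2_eqI[OF refl refl refl refl] that by blast

lemma mat2_adjugate:
  fixes a :: "'b::field"
  assumes "a * d - b * c = 1"
  shows "mat2 a b c d ** mat2 d (- b) (- c) a = mat 1"
    and "mat2 d (- b) (- c) a ** mat2 a b c d = mat 1"
  using assms by (simp_all add: mat2_mult mat_1_eq_mat2 algebra_simps)

lemma SL2_matrix_inv:
  fixes g :: "'b::field^2^2"
  assumes "g \<in> SL2"
  shows "g ** matrix_inv g = mat 1" "matrix_inv g ** g = mat 1"
proof -
  obtain a b c d where g: "g = mat2 a b c d" by (rule mat2_cases)
  then have "a * d - b * c = 1" using assms by (simp add: SL2_def det_mat2)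
  then have "\<exists>h. g ** h = mat 1 \<and> h ** g = mat 1" unfolding g using mat2_adjugate by blast
  then have "g ** matrix_inv g = mat 1 \<and> matrix_inv g ** g = mat 1"
    unfolding matrix_inv_def by (rule someI_ex)
  then show "g ** matrix_inv g = mat 1" "matrix_inv g ** g = mat 1" by blast+
qed

context sl2_weight
begin

lemma mat2_in_K0_iff:
  "mat2 a b c d \<in> K0 \<longleftrightarrow> a * d - b * c = 1 \<and> a \<in> val_ring v \<and> b \<in> val_ring v
     \<and> c \<in> val_ring v \<and> d \<in> val_ring v"
  by (auto simp: K0_def SL2_def det_mat2 forall_2)

lemma K0_mult:
  assumes "k \<in> K0" "l \<in> K0"
  shows "k ** l \<in> K0"
proof -
  have "(k ** l) $ i $ j \<in> val_ring v" for i j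
    using assms by (simp add: K0_def matrix_matrix_mult_def sum_2 val_ring_add val_ring_mult)
  then show ?thesis using assms by (simp add: K0_def SL2_mult)
qed

lemma K0_inverse:
  assumes "k \<in> K0"
  obtains l where "l \<in> K0" "l ** k = mat 1"
proof -
  obtain a b c d where k: "k = mat2 a b c d" by (rule mat2_cases)
  then have "mat2 d (- b) (- c) a \<in> K0"
    using assms by (simp add: mat2_in_K0_iff val_ring_minus mult.commute)
  moreover have "mat2 d (- b) (- c) a ** k = mat 1"
    using assms unfolding k by (intro mat2_adjugate) (simp add: mat2_in_K0_iff)
  ultimately show thesis by (rule that)
qed

lemma K0_mult_left_in_double_coset_iff:
  assumes "k \<in> K0"
  shows "k ** g \<in> double_coset n \<longleftrightarrow> g \<in> double_coset n"
proof -
  have stable: "l ** h \<in> double_coset n" if "l \<in> K0" "h \<in> double_coset n" for l h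
  proof -
    obtain k' i where "k' \<in> K0" "i \<in> IS1" "h = k' ** \<alpha>0_pow n ** i"
      using \<open>h \<in> double_coset n\<close> unfolding double_coset_def by blast
    then show ?thesis
      unfolding double_coset_def using K0_mult[OF \<open>l \<in> K0\<close>] by (auto simp: matrix_mul_assoc)
  qed
  obtain l where l: "l \<in> K0" "l ** k = mat 1" using K0_inverse[OF assms] .
  then have "g = l ** (k ** g)" by (simp add: matrix_mul_assoc)
  then show ?thesis using stable[OF assms] stable[OF l(1)] by metis
qed

lemma \<alpha>0_pow_simps:
  "\<alpha>0_pow 0 = mat 1"
  "\<alpha>0_pow 1 = mat2 (inverse \<pi>) 0 0 \<pi>"
  "\<alpha>0_pow (- 1) = mat2 \<pi> 0 0 (inverse \<pi>)"
  by (simp_all add: \<alpha>0_pow_def mat_1_eq_mat2 power_int_minus)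

lemma double_coset_0: "double_coset 0 \<subseteq> K0"
  unfolding double_coset_def \<alpha>0_pow_simps using K0_mult by (auto simp: IS1_def)

lemma std_fun_eq:
  assumes "g \<in> SL2"
  shows "std_fun g y = (\<lambda>x. if x ** g \<in> K0 then \<sigma> (x ** g) y else 0)"
proof -
  have "x \<in> (\<lambda>k. k ** matrix_inv g) ` K0 \<longleftrightarrow> x ** g \<in> K0" for x
  proof
    assume "x \<in> (\<lambda>k. k ** matrix_inv g) ` K0"
    then show "x ** g \<in> K0"
      using SL2_matrix_inv[OF assms] by (auto simp flip: matrix_mul_assoc)
  next
    assume "x ** g \<in> K0"
    moreover have "x = (x ** g) ** matrix_inv g"
      using SL2_matrix_inv[OF assms] by (simp flip: matrix_mul_assoc)
    ultimately show "x \<in> (\<lambda>k. k ** matrix_inv g) ` K0" by blast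
  qed
  then show ?thesis by (simp add: std_fun_def fun_eq_iff)
qed

lemma std_fun_nonzero_imp_double_coset:
  assumes "g \<in> SL2" "g ** \<alpha>0_pow n ** i = mat 1" "i \<in> IS1" "std_fun g y x \<noteq> 0"
  shows "x \<in> double_coset n"
proof -
  have "x ** g \<in> K0" using assms(1,4) by (auto simp: std_fun_eq split: if_splits)
  moreover have "x = x ** (g ** \<alpha>0_pow n ** i)" by (simp add: assms)
  then have "x = (x ** g) ** \<alpha>0_pow n ** i" by (simp add: matrix_mul_assoc)
  ultimately show ?thesis unfolding double_coset_def using assms(3) by blast
qed


section \<open>The coset representatives in the Hecke operator\<close>

lemma \<pi>_in_ideal_power: "\<pi> \<in> ideal_power 1" "inverse \<pi> \<in> ideal_power (- 1)"
  using uniformizer by (simp_all add: ideal_power_def val_inverse)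

lemma \<pi>_in_val_ring: "\<pi> \<in> val_ring v"
  using \<pi>_in_ideal_power by (simp add: max_ideal_imp_val_ring max_ideal_eq)

lemma residue_tuples_nth: "\<xi> \<in> residue_tuples m \<Longrightarrow> j < m \<Longrightarrow> \<xi> j \<in> carrier (residue_field v)"
  by (auto simp: residue_tuples_def PiE_def Pi_def)

lemma finite_residue_tuples: "finite (residue_tuples m)"
  by (simp add: residue_tuples_def finite_PiE finite_residue_field)

lemma A_in_val_ring: "\<xi> \<in> residue_tuples m \<Longrightarrow> A m \<xi> \<in> val_ring v"
  unfolding A_def
  by (intro val_ring_sum val_ring_mult val_ring_power \<pi>_in_val_ring teichmueller(1))
     (simp add: residue_tuples_nth)

lemma A_2: "A 2 \<xi> = teichmueller (\<xi> 0) + teichmueller (\<xi> 1) * \<pi>"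
  by (simp add: A_def numeral_2_eq_2)

lemma reduction_A_2:
  assumes "\<xi> \<in> residue_tuples 2"
  shows "reduction (A 2 \<xi>) = \<iota> (\<xi> 0)"
proof -
  have "reduction \<pi> = 0"
    using \<pi>_in_ideal_power by (simp add: reduction_eq_0_iff \<pi>_in_val_ring max_ideal_eq)
  then show ?thesis
    using teichmueller residue_tuples_nth[OF assms]
    by (simp add: A_2 reduction_add reduction_mult val_ring_mult \<pi>_in_val_ring)
qed

text \<open>
  The elements \<open>A 2 \<xi>\<close> represent the integers modulo the square of the maximal ideal: the
  reduction of such an element determines its zeroth digit, and after cancelling this digit one
  can divide by the uniformizer.
\<close>

lemma A_2_inj:
  assumes \<xi>: "\<xi> \<in> residue_tuples 2" and \<eta>: "\<eta> \<in> residue_tuples 2"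
    and diff: "A 2 \<xi> - A 2 \<eta> \<in> ideal_power 2"
  shows "\<xi> = \<eta>"
proof -
  have carrier: "\<xi> j \<in> carrier (residue_field v)" "\<eta> j \<in> carrier (residue_field v)" if "j < 2" for j
    using that residue_tuples_nth \<xi> \<eta> by auto
  note inj = inj_onD[OF embedding_inj]
  have "A 2 \<xi> - A 2 \<eta> \<in> max_ideal v"
    using ideal_power_mono[OF _ diff] by (simp add: max_ideal_eq)
  then have "\<iota> (\<xi> 0) = \<iota> (\<eta> 0)"
    using \<xi> \<eta> by (simp add: reduction_eq_iff A_in_val_ring flip: reduction_A_2)
  then have 0: "\<xi> 0 = \<eta> 0" using inj carrier by simp
  let ?d = "teichmueller (\<xi> 1) - teichmueller (\<eta> 1)"
  have "A 2 \<xi> - A 2 \<eta> = ?d * \<pi>" by (simp add: A_2 0 algebra_simps)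
  then have "?d * \<pi> * inverse \<pi> \<in> ideal_power (2 + - 1)"
    using ideal_power_mult[OF diff \<pi>_in_ideal_power(2)] by simp
  then have "?d \<in> max_ideal v" using uniformizer by (simp add: mult.assoc max_ideal_eq)
  then have "\<iota> (\<xi> 1) = \<iota> (\<eta> 1)"
    using teichmueller carrier reduction_eq_iff[of "teichmueller (\<xi> 1)" "teichmueller (\<eta> 1)"]
    by simp
  then have 1: "\<xi> 1 = \<eta> 1" using inj carrier by simp
  show ?thesis
  proof (rule PiE_ext[of _ "{..<2}" "\<lambda>_. carrier (residue_field v)"])
    show "\<xi> j = \<eta> j" if "j \<in> {..<2}" for j
      using that 0 1 by (auto simp: less_2_cases_iff)
  qed (use \<xi> \<eta> in \<open>simp_all add: residue_tuples_def\<close>)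
qed

definition upper_rep :: "(nat \<Rightarrow> 'a set) \<Rightarrow> 'a^2^2" where
  "upper_rep \<xi> = mat 1 ** mat2 1 (A 2 \<xi>) 0 1 ** \<alpha>0_pow (- 1)"

definition lower_rep :: "(nat \<Rightarrow> 'a set) \<Rightarrow> 'a^2^2" where
  "lower_rep \<mu> = mat 1 ** mat2 1 0 (\<pi> * A 1 \<mu>) 1 ** \<alpha>0_pow 1"

lemma upper_rep_eq: "upper_rep \<xi> = mat2 \<pi> (A 2 \<xi> * inverse \<pi>) 0 (inverse \<pi>)"
  by (simp add: upper_rep_def \<alpha>0_pow_simps mat2_mult)

lemma lower_rep_eq: "lower_rep \<mu> = mat2 (inverse \<pi>) 0 (A 1 \<mu>) \<pi>"
  using uniformizer by (simp add: lower_rep_def \<alpha>0_pow_simps mat2_mult field_simps)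

lemma upper_rep_in_SL2: "upper_rep \<xi> \<in> SL2"
  using uniformizer by (simp add: upper_rep_eq SL2_def det_mat2)

lemma lower_rep_in_SL2: "lower_rep \<mu> \<in> SL2"
  using uniformizer by (simp add: lower_rep_eq SL2_def det_mat2)

lemma upper_rep_support:
  assumes "\<xi> \<in> residue_tuples 2" "std_fun (upper_rep \<xi>) y x \<noteq> 0"
  shows "x \<in> double_coset 1"
proof (rule std_fun_nonzero_imp_double_coset[OF upper_rep_in_SL2 _ _ assms(2)])
  show "upper_rep \<xi> ** \<alpha>0_pow 1 ** mat2 1 (- A 2 \<xi>) 0 1 = mat 1"
    using uniformizer by (simp add: upper_rep_eq \<alpha>0_pow_simps mat2_mult mat_1_eq_mat2 mult.assoc)
  show "mat2 1 (- A 2 \<xi>) 0 1 \<in> IS1"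
    using A_in_val_ring[OF assms(1)]
    by (simp add: IS1_def mat2_in_K0_iff max_ideal_eq val_ring_minus)
qed

lemma lower_rep_support:
  assumes "\<mu> \<in> residue_tuples 1" "std_fun (lower_rep \<mu>) y x \<noteq> 0"
  shows "x \<in> double_coset (- 1)"
proof (rule std_fun_nonzero_imp_double_coset[OF lower_rep_in_SL2 _ _ assms(2)])
  show "lower_rep \<mu> ** \<alpha>0_pow (- 1) ** mat2 1 0 (- \<pi> * A 1 \<mu>) 1 = mat 1"
    using uniformizer by (simp add: lower_rep_eq \<alpha>0_pow_simps mat2_mult mat_1_eq_mat2)
  have "\<pi> * A 1 \<mu> \<in> max_ideal v"
    using ideal_power_mult[of \<pi> 1 "A 1 \<mu>" 0] A_in_val_ring[OF assms(1)] \<pi>_in_ideal_power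
    by (simp add: max_ideal_eq val_ring_eq)
  then show "mat2 1 0 (- \<pi> * A 1 \<mu>) 1 \<in> IS1"
    by (simp add: IS1_def mat2_in_K0_iff max_ideal_imp_val_ring val_ring_minus max_ideal_eq
        ideal_power_minus)
qed

text \<open>
  The inverse of \<open>upper_rep \<xi>\<close>, hence a representative of the coset on which the summand of the
  Hecke operator belonging to \<open>\<xi>\<close> is supported. The two lemmas on products with the coset
  representatives say that no other summand is supported there.
\<close>

definition test_point :: "(nat \<Rightarrow> 'a set) \<Rightarrow> 'a^2^2" where
  "test_point \<xi> = mat2 (inverse \<pi>) (- A 2 \<xi> * inverse \<pi>) 0 \<pi>"

lemma test_point_upper_rep:
  "test_point \<xi> ** upper_rep \<eta> = mat2 1 ((A 2 \<eta> - A 2 \<xi>) * inverse (\<pi>\<^sup>2)) 0 1"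
  using uniformizer
  by (simp add: test_point_def upper_rep_eq mat2_mult field_simps power2_eq_square)

lemma test_point_upper_rep_in_K0_iff:
  assumes "\<xi> \<in> residue_tuples 2" "\<eta> \<in> residue_tuples 2"
  shows "test_point \<xi> ** upper_rep \<eta> \<in> K0 \<longleftrightarrow> \<eta> = \<xi>"
proof
  assume "test_point \<xi> ** upper_rep \<eta> \<in> K0"
  then have "(A 2 \<eta> - A 2 \<xi>) * inverse (\<pi>\<^sup>2) \<in> ideal_power 0"
    by (simp add: test_point_upper_rep mat2_in_K0_iff val_ring_eq)
  moreover have "\<pi>\<^sup>2 \<in> ideal_power 2"
    using ideal_power_mult[OF \<pi>_in_ideal_power(1) \<pi>_in_ideal_power(1)]
    by (simp add: power2_eq_square)
  ultimately have "(A 2 \<eta> - A 2 \<xi>) * inverse (\<pi>\<^sup>2) * \<pi>\<^sup>2 \<in> ideal_power (0 + 2)"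
    by (rule ideal_power_mult)
  then have "A 2 \<eta> - A 2 \<xi> \<in> ideal_power 2" using uniformizer by (simp add: mult.assoc)
  then show "\<eta> = \<xi>" using A_2_inj assms by blast
qed (simp add: test_point_upper_rep mat2_in_K0_iff)

text \<open>
  The upper left entry of the product is \<open>\<pi>\<^sup>-\<^sup>2\<close> times an element congruent to 1 modulo the
  maximal ideal.
\<close>

lemma test_point_lower_rep_notin_K0:
  assumes "\<xi> \<in> residue_tuples 2" "\<mu> \<in> residue_tuples 1"
  shows "test_point \<xi> ** lower_rep \<mu> \<notin> K0"
proof
  let ?c = "\<pi> * (A 2 \<xi> * A 1 \<mu>)"
  assume "test_point \<xi> ** lower_rep \<mu> \<in> K0"
  then have "inverse \<pi> * inverse \<pi> - A 2 \<xi> * inverse \<pi> * A 1 \<mu> \<in> ideal_power 0"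
    by (simp add: test_point_def lower_rep_eq mat2_mult mat2_in_K0_iff val_ring_eq)
  then have "\<pi> * (\<pi> * (inverse \<pi> * inverse \<pi> - A 2 \<xi> * inverse \<pi> * A 1 \<mu>))
      \<in> ideal_power (1 + (1 + 0))"
    by (intro ideal_power_mult \<pi>_in_ideal_power)
  moreover have "\<pi> * (\<pi> * (inverse \<pi> * inverse \<pi> - A 2 \<xi> * inverse \<pi> * A 1 \<mu>)) = 1 - ?c"
    using uniformizer by (simp add: field_simps)
  ultimately have "1 - ?c \<in> ideal_power 1" using ideal_power_mono[of 1 2] by simp
  moreover have "A 2 \<xi> * A 1 \<mu> \<in> ideal_power 0"
    using A_in_val_ring assms val_ring_mult by (simp flip: val_ring_eq)
  then have "?c \<in> ideal_power 1"
    using ideal_power_mult[OF \<pi>_in_ideal_power(1)] by fastforce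
  ultimately have "1 - ?c + ?c \<in> ideal_power 1" by (rule ideal_power_add)
  then show False by (simp add: ideal_power_def val_one)
qed

end


section \<open>Exponents below the size of the field\<close>

text \<open>
  A nonzero polynomial whose exponents stay below the number of points in \<open>S\<close> has too small a
  degree to vanish on all of \<open>S\<close>. Applied to the residue field, this separates monomials
  exactly up to degree \<open>q - 1\<close>, which is the range of exponents coming from the weight.
\<close>

lemma power_sum_distinct_exponents_eq_0:
  fixes c :: "'i \<Rightarrow> 'b::idom"
  assumes I: "finite I" "inj_on N I" and bound: "\<And>l. l \<in> I \<Longrightarrow> N l < card S"
    and zero: "\<And>x. x \<in> S \<Longrightarrow> (\<Sum>l\<in>I. c l * x ^ N l) = 0" and l: "l \<in> I"
  shows "c l = 0"
proof -
  define P where "P = (\<Sum>l\<in>I. Polynomial.monom (c l) (N l))"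
  have "P = 0"
  proof (rule ccontr)
    assume "P \<noteq> 0"
    have "Polynomial.degree P \<le> card S - 1"
      unfolding P_def
      by (rule degree_sum_le[OF I(1)], rule order_trans[OF degree_monom_le]) (use bound in force)
    also have "\<dots> < card S" using bound[OF l] by simp
    also have "\<dots> \<le> card {x. poly P x = 0}"
      using zero \<open>P \<noteq> 0\<close>
      by (intro card_mono poly_roots_finite) (auto simp: P_def poly_sum poly_monom)
    also have "\<dots> \<le> Polynomial.degree P" by (rule card_poly_roots_bound[OF \<open>P \<noteq> 0\<close>])
    finally show False by simp
  qed
  have "c l = (\<Sum>k\<in>I. if k = l then c k else 0)" using I(1) l by simp
  also have "\<dots> = (\<Sum>k\<in>I. Polynomial.coeff (Polynomial.monom (c k) (N k)) (N l))"
    using inj_onD[OF I(2) _ _ l] by (intro sum.cong) auto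
  also have "\<dots> = Polynomial.coeff P (N l)" by (simp add: P_def coeff_sum)
  finally show ?thesis by (simp add: \<open>P = 0\<close>)
qed

text \<open>
  The bound on the digits excludes carries: the base \<open>b\<close> expansion of length
  \<open>n\<close> represents a number below \<open>b\<^sup>n\<close>, and division by \<open>b\<^sup>n\<close> reads off the next digit.
\<close>

lemma digit_sum_less:
  fixes b :: nat
  assumes "\<And>i. i < n \<Longrightarrow> l i < b"
  shows "(\<Sum>i<n. l i * b ^ i) < b ^ n"
  using assms
proof (induction n)
  case (Suc n)
  then have "(\<Sum>i<n. l i * b ^ i) < b ^ n" by simp
  moreover have "Suc (l n) * b ^ n \<le> b * b ^ n"
    using Suc.prems[of n] by (intro mult_right_mono) simp_all
  ultimately show ?case by simp
qed simp

lemma digit_sum_inj: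
  fixes b :: nat
  assumes "\<And>i. i < n \<Longrightarrow> l i < b" "\<And>i. i < n \<Longrightarrow> m i < b"
    and "(\<Sum>i<n. l i * b ^ i) = (\<Sum>i<n. m i * b ^ i)" and "i < n"
  shows "l i = m i"
  using assms
proof (induction n)
  case (Suc n)
  let ?L = "\<Sum>i<n. l i * b ^ i" and ?M = "\<Sum>i<n. m i * b ^ i"
  have less: "?L < b ^ n" "?M < b ^ n" using Suc.prems(1,2) by (simp_all add: digit_sum_less)
  have eq: "?L + l n * b ^ n = ?M + m n * b ^ n" using Suc.prems(3) by simp
  have "b > 0" using Suc.prems(1)[of n] by simp
  then have "l n = (?L + l n * b ^ n) div b ^ n" using less by simp
  also have "\<dots> = m n" unfolding eq using less \<open>b > 0\<close> by simp
  finally have top: "l n = m n" .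
  show ?case
  proof (cases "i = n")
    case False
    then show ?thesis using Suc.IH Suc.prems eq top by simp
  qed (simp add: top)
qed simp


section \<open>The top coefficient of a twisted vector\<close>

lemma coeff_mult_of_degree_le:
  fixes f g :: "'b::comm_semiring_0 poly"
  assumes "Polynomial.degree f \<le> m" "Polynomial.degree g \<le> n"
  shows "Polynomial.coeff (f * g) (m + n) = Polynomial.coeff f m * Polynomial.coeff g n"
proof -
  have "Polynomial.coeff f i * Polynomial.coeff g (m + n - i) = 0" if "i \<noteq> m" "i \<le> m + n" for i
    using that assms by (cases "i < m") (simp_all add: coeff_eq_0)
  then have "Polynomial.coeff (f * g) (m + n) = (\<Sum>i\<le>m + n. if i = m then Polynomial.coeff f m * Polynomial.coeff g n else 0)"
    unfolding coeff_mult by (intro sum.cong) auto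
  then show ?thesis by simp
qed

lemma coeff_power_top:
  fixes f :: "'b::comm_semiring_1 poly"
  assumes "Polynomial.degree f \<le> 1"
  shows "Polynomial.degree (f ^ n) \<le> n" "Polynomial.coeff (f ^ n) n = Polynomial.coeff f 1 ^ n"
proof -
  show deg: "Polynomial.degree (f ^ n) \<le> n" for n
    using order_trans[OF degree_power_le mult_right_mono[OF assms]] by simp
  show "Polynomial.coeff (f ^ n) n = Polynomial.coeff f 1 ^ n"
  proof (induction n)
    case (Suc n)
    have "Polynomial.coeff (f * f ^ n) (1 + n) = Polynomial.coeff f 1 * Polynomial.coeff (f ^ n) n"
      by (rule coeff_mult_of_degree_le) (use assms deg in auto)
    with Suc show ?case by simp
  qed simp
qed

context sl2_weight
begin

text \<open>
  At the top degree only the leading terms of the linear factors contribute, so the first row of the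
  matrix drops out.
\<close>

lemma sym_coeff_top:
  assumes "l \<le> s"
  shows "sym_coeff s M l s = (M $ 2 $ 1) ^ (s - l) * (M $ 2 $ 2) ^ l"
proof -
  let ?f = "[:M $ 1 $ 1, M $ 2 $ 1:]" and ?g = "[:M $ 1 $ 2, M $ 2 $ 2:]"
  have "Polynomial.coeff (?f ^ (s - l) * ?g ^ l) ((s - l) + l) = Polynomial.coeff (?f ^ (s - l)) (s - l) * Polynomial.coeff (?g ^ l) l"
    by (rule coeff_mult_of_degree_le) (simp_all add: coeff_power_top)
  with assms show ?thesis by (simp add: sym_coeff_def coeff_power_top)
qed

lemma sym_coeff_bottom: "sym_coeff s M s 0 = (M $ 1 $ 2) ^ s"
  by (simp add: sym_coeff_def coeff_0_power)

lemma sym_coeff_identity: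
  fixes M :: "'k^2^2"
  assumes "M $ 1 $ 1 = 1" "M $ 1 $ 2 = 0" "M $ 2 $ 1 = 0" "M $ 2 $ 2 = 1"
  shows "sym_coeff s M l m = (if l = m then 1 else 0)"
proof -
  have "pCons 0 1 ^ l = Polynomial.monom (1 :: 'k) l"
    by (simp add: monom_altdef one_pCons)
  then show ?thesis using assms by (simp add: sym_coeff_def flip: one_pCons)
qed

lemma finite_weight_index: "finite weight_index"
  by (simp add: weight_index_def finite_PiE)

lemma weight_index_le: "l \<in> weight_index \<Longrightarrow> i < e \<Longrightarrow> l i \<le> r i"
  by (auto simp: weight_index_def PiE_def Pi_def)

lemma weight_index_eqI:
  "l \<in> weight_index \<Longrightarrow> m \<in> weight_index \<Longrightarrow> (\<And>i. i < e \<Longrightarrow> l i = m i) \<Longrightarrow> l = m"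
  unfolding weight_index_def by (rule PiE_ext) auto

definition top_index :: "nat \<Rightarrow> nat" where
  "top_index = restrict r {..<e}"

definition bottom_index :: "nat \<Rightarrow> nat" where
  "bottom_index = restrict (\<lambda>_. 0) {..<e}"

lemma top_index_mem: "top_index \<in> weight_index"
  and bottom_index_mem: "bottom_index \<in> weight_index"
  by (auto simp: top_index_def bottom_index_def weight_index_def)

lemma top_index_nth: "i < e \<Longrightarrow> top_index i = r i"
  and bottom_index_nth: "i < e \<Longrightarrow> bottom_index i = 0"
  by (simp_all add: top_index_def bottom_index_def)

lemma top_index_iff:
  assumes "l \<in> weight_index"
  shows "l = top_index \<longleftrightarrow> (\<forall>i<e. l i = r i)"
proof
  assume "\<forall>i<e. l i = r i"
  then show "l = top_index"
    by (intro weight_index_eqI[OF assms top_index_mem]) (simp add: top_index_nth)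
qed (simp add: top_index_nth)

lemma prod_indicator:
  "(\<Prod>i<n. if P i then 1 else 0) = (if \<forall>i<n. P i then 1 else (0 :: 'b::comm_semiring_1))"
  for n :: nat
  by (induction n) (auto simp: less_Suc_eq)

lemma \<sigma>_apply:
  "m \<in> weight_index \<Longrightarrow> \<sigma> k y m = (\<Sum>l\<in>weight_index.
     (\<Prod>i<e. sym_coeff (r i) (\<chi> a b. reduction (k $ a $ b) ^ (p ^ i)) (l i) (m i)) * y l)"
  by (simp add: \<sigma>_def tensor_map_def)

lemma \<sigma>_one_apply:
  assumes "m \<in> weight_index"
  shows "\<sigma> (mat 1) y m = y m"
proof -
  have "p > 0" using prime_p by (rule prime_gt_0_nat)
  then have "\<sigma> (mat 1) y m = (\<Sum>l\<in>weight_index. (\<Prod>i<e. if l i = m i then 1 else 0) * y l)"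
    unfolding \<sigma>_apply[OF assms]
    by (intro sum.cong prod.cong arg_cong2[of _ _ _ _ "(*)"] sym_coeff_identity)
       (simp_all add: mat_def)
  also have "\<dots> = (\<Sum>l\<in>weight_index. if l = m then y l else 0)"
    by (intro sum.cong) (use assms weight_index_eqI in \<open>auto simp: prod_indicator\<close>)
  also have "\<dots> = y m" using assms finite_weight_index by simp
  finally show ?thesis .
qed

lemma U_apply: "U y = (\<lambda>m. if m = top_index then y top_index else 0)"
proof
  fix m
  show "U y m = (if m = top_index then y top_index else 0)"
  proof (cases "m \<in> weight_index")
    case False
    then show ?thesis using top_index_mem by (auto simp: U_def tensor_map_def)
  next
    case True
    have "U y m = (\<Sum>l\<in>weight_index. (if \<forall>i<e. l i = r i \<and> m i = r i then 1 else 0) * y l)"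
      using True unfolding U_def tensor_map_def prod_indicator by simp
    also have "\<dots> = (\<Sum>l\<in>weight_index. (if l = top_index \<and> m = top_index then 1 else 0) * y l)"
    proof (rule sum.cong)
      fix l assume "l \<in> weight_index"
      then have "(\<forall>i<e. l i = r i \<and> m i = r i) \<longleftrightarrow> l = top_index \<and> m = top_index"
        using top_index_iff True by blast
      then show "(if \<forall>i<e. l i = r i \<and> m i = r i then 1 else 0) * y l
          = (if l = top_index \<and> m = top_index then 1 else 0) * y l"
        by simp
    qed simp
    also have "\<dots> = (\<Sum>l\<in>weight_index. if l = top_index then if m = top_index then y l else 0 else 0)"
      by (intro sum.cong) auto
    also have "\<dots> = (if m = top_index then y top_index else 0)"
      using finite_weight_index top_index_mem by simp
    finally show ?thesis .
  qed
qed

text \<open>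
  The Weyl element sends the highest power of \<open>Y\<close> to the highest power of \<open>X\<close> up to sign, so the
  coefficient of the latter recovers the only nonzero coordinate of a vector in the image of \<open>U\<close>.
\<close>

lemma \<sigma>_w0_U_bottom:
  "\<exists>c. c \<noteq> 0 \<and> (\<forall>y. \<sigma> w0 (U y) bottom_index = c * y top_index)"
proof (intro exI conjI allI)
  let ?c = "\<Prod>i<e. (reduction (- 1) ^ (p ^ i)) ^ r i"
  show "?c \<noteq> 0" by (simp add: reduction_minus)
  fix y
  let ?F = "\<lambda>l. \<Prod>i<e. sym_coeff (r i) (\<chi> a b. reduction (w0 $ a $ b) ^ (p ^ i)) (l i) (bottom_index i)"
  have "\<sigma> w0 (U y) bottom_index
      = (\<Sum>l\<in>weight_index. if l = top_index then ?F top_index * y top_index else 0)"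
    unfolding \<sigma>_apply[OF bottom_index_mem] by (intro sum.cong) (auto simp: U_apply)
  also have "\<dots> = ?F top_index * y top_index"
    using finite_weight_index top_index_mem by simp
  also have "?F top_index = ?c"
    by (intro prod.cong)
       (simp_all add: top_index_nth bottom_index_nth sym_coeff_bottom w0_def)
  finally show "\<sigma> w0 (U y) bottom_index = ?c * y top_index" .
qed

definition exponent :: "(nat \<Rightarrow> nat) \<Rightarrow> nat" where
  "exponent l = (\<Sum>i<e. l i * p ^ i)"

lemma weight_index_less: "l \<in> weight_index \<Longrightarrow> i < e \<Longrightarrow> l i < p"
  using weight_index_le[of l i] weight_range[of i] prime_gt_0_nat[OF prime_p] by simp

lemma exponent_less: "l \<in> weight_index \<Longrightarrow> exponent l < p ^ e"
  unfolding exponent_def by (rule digit_sum_less) (rule weight_index_less)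

lemma exponent_inj: "inj_on exponent weight_index"
proof (rule inj_onI, rule weight_index_eqI)
  fix l m i
  assume "l \<in> weight_index" "m \<in> weight_index" "exponent l = exponent m" "i < e"
  then show "l i = m i"
    using digit_sum_inj[of e l p m i] weight_index_less by (simp add: exponent_def)
qed

text \<open>
  The matrix sends \<open>X\<close> to \<open>-Y\<close> and \<open>Y\<close> to \<open>X + a Y\<close>, with its \<open>p\<^sup>i\<close>-th power Frobenius twist on
  the \<open>i\<close>-th factor. Hence the basis vector with exponents \<open>l\<close> contributes \<open>a\<close> to the power
  \<open>\<Sum>i. l i * p\<^sup>i\<close>, up to sign, to the coefficient of the highest power of \<open>Y\<close>.
\<close>

lemma \<sigma>_twist_top:
  assumes "a \<in> val_ring v"
  shows "\<sigma> (mat2 0 1 (- 1) a) y top_index =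
    (\<Sum>l\<in>weight_index. (\<Prod>i<e. ((- 1) ^ (p ^ i)) ^ (r i - l i)) * y l * reduction a ^ exponent l)"
proof -
  have "(\<Prod>i<e. sym_coeff (r i) (\<chi> b c. reduction (mat2 0 1 (- 1) a $ b $ c) ^ (p ^ i)) (l i) (top_index i))
      = (\<Prod>i<e. ((- 1) ^ (p ^ i)) ^ (r i - l i)) * reduction a ^ exponent l"
    if "l \<in> weight_index" for l
  proof -
    have "(\<Prod>i<e. sym_coeff (r i) (\<chi> b c. reduction (mat2 0 1 (- 1) a $ b $ c) ^ (p ^ i)) (l i) (top_index i))
        = (\<Prod>i<e. ((- 1) ^ (p ^ i)) ^ (r i - l i) * reduction a ^ (l i * p ^ i))"
      using weight_index_le[OF that]
      by (intro prod.cong)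
         (simp_all add: top_index_nth sym_coeff_top reduction_minus mult.commute flip: power_mult)
    then show ?thesis by (simp add: prod.distrib exponent_def power_sum)
  qed
  then show ?thesis
    unfolding \<sigma>_apply[OF top_index_mem] by (intro sum.cong) (simp_all add: ac_simps)
qed

text \<open>
  By the formula for the top coefficient, the hypothesis says that a polynomial function with the
  coordinates of \<open>y - z\<close> as coefficients, up to sign, vanishes on the whole residue field. Its
  exponents are the numbers with base \<open>p\<close> digits \<open>l i\<close>: they are distinct and less than \<open>q = p\<^sup>e\<close>.
\<close>

lemma twist_top_injective:
  assumes y: "y \<in> weight_space" and z: "z \<in> weight_space"
    and eq: "\<And>c. c \<in> carrier (residue_field v) \<Longrightarrow> \<exists>a\<in>val_ring v. reduction a = \<iota> c
        \<and> \<sigma> (mat2 0 1 (- 1) a) y top_index = \<sigma> (mat2 0 1 (- 1) a) z top_index"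
  shows "y = z"
proof
  fix l
  define s :: "(nat \<Rightarrow> nat) \<Rightarrow> 'k" where "s l = (\<Prod>i<e. ((- 1) ^ (p ^ i)) ^ (r i - l i))" for l
  show "y l = z l"
  proof (cases "l \<in> weight_index")
    case False
    then show ?thesis using y z by (simp add: weight_space_def)
  next
    case True
    have "s l * (y l - z l) = 0"
    proof (rule power_sum_distinct_exponents_eq_0[OF finite_weight_index exponent_inj _ _ True,
          where c = "\<lambda>l. s l * (y l - z l)"])
      show "exponent m < card residue_image" if "m \<in> weight_index" for m
        using exponent_less[OF that] by (simp add: card_residue_image)
      fix x assume "x \<in> residue_image"
      then obtain c where "c \<in> carrier (residue_field v)" "x = \<iota> c"
        by (auto simp: residue_image_eq)
      then obtain a where "a \<in> val_ring v" "reduction a = x"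
        "\<sigma> (mat2 0 1 (- 1) a) y top_index = \<sigma> (mat2 0 1 (- 1) a) z top_index"
        using eq by blast
      then show "(\<Sum>m\<in>weight_index. s m * (y m - z m) * x ^ exponent m) = 0"
        by (simp add: \<sigma>_twist_top s_def right_diff_distrib left_diff_distrib sum_subtractf)
    qed
    moreover have "s l \<noteq> 0" by (simp add: s_def)
    ultimately show ?thesis by simp
  qed
qed


section \<open>The image of a function supported on the maximal compact subgroup\<close>

lemma sum_fun_apply: "(\<Sum>i\<in>I. f i) x = (\<Sum>i\<in>I. f i x)"
  for f :: "'i \<Rightarrow> 'b \<Rightarrow> 'c::comm_monoid_add"
  by (induction I rule: infinite_finite_induct) simp_all

text \<open>
  Since the double coset of \<open>\<alpha>0_pow 0\<close> is \<open>K0\<close> itself, equivariance determines a function in \<open>C0\<close> by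
  its value at the identity.
\<close>

lemma C0_eq_std_fun:
  assumes "f \<in> C0"
  shows "f = std_fun (mat 1) (f (mat 1))" "f (mat 1) \<in> weight_space"
proof -
  have f: "f \<in> ind" "{g. f g \<noteq> 0} \<subseteq> K0"
    using assms double_coset_0 by (auto simp: C0_def R_plus_def)
  show "f = std_fun (mat 1) (f (mat 1))"
  proof
    fix x
    have "f (x ** mat 1) = \<sigma> x (f (mat 1))" if "x \<in> K0"
      using f(1) that mat_1_in_SL2 unfolding ind_def by blast
    with f(2) show "f x = std_fun (mat 1) (f (mat 1)) x"
      by (auto simp: std_fun_eq mat_1_in_SL2)
  qed
  show "f (mat 1) \<in> weight_space" using f(1) mat_1_in_SL2 unfolding ind_def by blast
qed

text \<open>
  An element of the compact induction is cut into pieces by restricting it to sets stable under left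
  multiplication by \<open>K0\<close>; equivariance of the pieces is then inherited, and the coset
  representatives of the support need only be intersected with the set.
\<close>

lemma restrict_in_ind:
  assumes f: "f \<in> ind" and D: "\<And>k g. k \<in> K0 \<Longrightarrow> k ** g \<in> D \<longleftrightarrow> g \<in> D"
  shows "(\<lambda>g. if g \<in> D then f g else 0) \<in> ind"
proof -
  obtain S where S: "finite S" "S \<subseteq> SL2" "{g. f g \<noteq> 0} = (\<Union>g\<in>S. (\<lambda>k. k ** g) ` K0)"
    using f unfolding ind_def by blast
  have "{g. (if g \<in> D then f g else 0) \<noteq> 0} = {g. f g \<noteq> 0} \<inter> D" by auto
  also have "\<dots> = (\<Union>g\<in>S \<inter> D. (\<lambda>k. k ** g) ` K0)" unfolding S(3) using D by auto
  finally have support: "{g. (if g \<in> D then f g else 0) \<noteq> 0}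
      = (\<Union>g\<in>S \<inter> D. (\<lambda>k. k ** g) ` K0)" .
  have "\<sigma> k 0 = 0" for k by (simp add: \<sigma>_def tensor_map_def fun_eq_iff)
  then have "\<forall>k\<in>K0. \<forall>g\<in>SL2. (if k ** g \<in> D then f (k ** g) else 0)
      = \<sigma> k (if g \<in> D then f g else 0)"
    using f D by (simp add: ind_def)
  moreover have "\<forall>g\<in>SL2. (if g \<in> D then f g else 0) \<in> weight_space"
    using f by (simp add: ind_def weight_space_def)
  moreover have "\<forall>g. g \<notin> SL2 \<longrightarrow> (if g \<in> D then f g else 0) = 0"
    using f by (simp add: ind_def)
  moreover have "finite (S \<inter> D) \<and> S \<inter> D \<subseteq> SL2" using S(1,2) by blast
  ultimately show ?thesis unfolding ind_def using support by blast
qed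

lemma hecke_operator_std_fun:
  assumes "hecke_operator \<tau>" "y \<in> weight_space"
  shows "\<tau> (std_fun (mat 1) y) x =
      (\<Sum>\<xi>\<in>residue_tuples 2. std_fun (upper_rep \<xi>) (\<sigma> w0 (U (\<sigma> (mat2 0 1 (- 1) (A 2 \<xi>)) y))) x)
    + (\<Sum>\<mu>\<in>residue_tuples 1. std_fun (lower_rep \<mu>) (U y) x)"
proof -
  have "\<tau> (std_fun (mat 1) y) =
      (\<Sum>\<xi>\<in>residue_tuples 2. std_fun (upper_rep \<xi>) (\<sigma> w0 (U (\<sigma> (mat2 0 1 (- 1) (A 2 \<xi>)) y))))
    + (\<Sum>\<mu>\<in>residue_tuples 1. std_fun (lower_rep \<mu>) (U y))"
    unfolding upper_rep_def lower_rep_def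
    by (rule assms(1)[unfolded hecke_operator_def, THEN conjunct2, THEN conjunct2,
          THEN conjunct2, THEN conjunct2, THEN bspec, OF mat_1_in_SL2, THEN bspec, OF assms(2)])
  then show ?thesis by (simp add: sum_fun_apply)
qed

lemma hecke_image_in_C1:
  assumes \<tau>: "hecke_operator \<tau>" and f: "f \<in> C0"
  shows "\<tau> f \<in> C1"
proof -
  let ?D = "double_coset 1"
  let ?f1 = "\<lambda>g. if g \<in> ?D then \<tau> f g else 0" and ?f2 = "\<lambda>g. if g \<in> - ?D then \<tau> f g else 0"
  have "f \<in> ind" using f by (simp add: C0_def R_plus_def)
  then have ind: "\<tau> f \<in> ind" using \<tau> by (simp add: hecke_operator_def)
  have support: "g \<in> ?D \<or> g \<in> double_coset (- 1)" if nz: "\<tau> f g \<noteq> 0" for g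
  proof (rule ccontr)
    assume outside: "\<not> ?thesis"
    then have "std_fun (upper_rep \<xi>) y g = 0" if "\<xi> \<in> residue_tuples 2" for \<xi> y
      using upper_rep_support[OF that] by blast
    moreover have "std_fun (lower_rep \<mu>) y g = 0" if "\<mu> \<in> residue_tuples 1" for \<mu> y
      using lower_rep_support[OF that] outside by blast
    ultimately have "\<tau> (std_fun (mat 1) (f (mat 1))) g = 0"
      unfolding hecke_operator_std_fun[OF \<tau> C0_eq_std_fun(2)[OF f]] by simp
    with nz show False by (simp flip: C0_eq_std_fun(1)[OF f])
  qed
  have "?f1 \<in> R_plus 1"
    unfolding R_plus_def using restrict_in_ind[OF ind K0_mult_left_in_double_coset_iff] by auto
  moreover have "?f2 \<in> R_minus 0"
    unfolding R_minus_def
    using restrict_in_ind[OF ind, of "- ?D"] K0_mult_left_in_double_coset_iff support by auto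
  moreover have "\<tau> f = ?f1 + ?f2" by (auto simp: fun_eq_iff)
  ultimately show ?thesis unfolding C1_def by blast
qed

text \<open>
  The coset of a test point meets the support of one summand of the Hecke operator only, so
  evaluating there isolates this summand.
\<close>

lemma hecke_value_at_test_point:
  assumes \<tau>: "hecke_operator \<tau>" and y: "y \<in> weight_space" and \<xi>: "\<xi> \<in> residue_tuples 2"
  shows "\<tau> (std_fun (mat 1) y) (test_point \<xi>) =
    \<sigma> (mat 1) (\<sigma> w0 (U (\<sigma> (mat2 0 1 (- 1) (A 2 \<xi>)) y)))"
proof -
  let ?w = "\<lambda>\<eta>. \<sigma> w0 (U (\<sigma> (mat2 0 1 (- 1) (A 2 \<eta>)) y))"
  have "std_fun (upper_rep \<eta>) (?w \<eta>) (test_point \<xi>) = (if \<eta> = \<xi> then \<sigma> (mat 1) (?w \<xi>) else 0)"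
    if "\<eta> \<in> residue_tuples 2" for \<eta>
    using test_point_upper_rep_in_K0_iff[OF \<xi> that]
    by (auto simp: std_fun_eq upper_rep_in_SL2 test_point_upper_rep mat_1_eq_mat2)
  then have "(\<Sum>\<eta>\<in>residue_tuples 2. std_fun (upper_rep \<eta>) (?w \<eta>) (test_point \<xi>))
      = (\<Sum>\<eta>\<in>residue_tuples 2. if \<eta> = \<xi> then \<sigma> (mat 1) (?w \<xi>) else 0)"
    by (intro sum.cong) simp_all
  also have "\<dots> = \<sigma> (mat 1) (?w \<xi>)" using \<xi> finite_residue_tuples by simp
  finally have "(\<Sum>\<eta>\<in>residue_tuples 2. std_fun (upper_rep \<eta>) (?w \<eta>) (test_point \<xi>))
      = \<sigma> (mat 1) (?w \<xi>)" .
  moreover have "(\<Sum>\<mu>\<in>residue_tuples 1. std_fun (lower_rep \<mu>) (U y) (test_point \<xi>)) = 0"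
    using test_point_lower_rep_notin_K0[OF \<xi>]
    by (intro sum.neutral) (simp add: std_fun_eq lower_rep_in_SL2)
  ultimately show ?thesis by (simp add: hecke_operator_std_fun[OF \<tau> y])
qed

lemma hecke_injective_on_C0:
  assumes \<tau>: "hecke_operator \<tau>"
  shows "inj_on \<tau> C0"
proof (rule inj_onI)
  fix f h assume f: "f \<in> C0" and h: "h \<in> C0" and eq: "\<tau> f = \<tau> h"
  let ?y = "f (mat 1)" and ?z = "h (mat 1)"
  note y = C0_eq_std_fun[OF f] and z = C0_eq_std_fun[OF h]
  obtain b where b: "b \<noteq> 0" "\<And>x. \<sigma> w0 (U x) bottom_index = b * x top_index"
    using \<sigma>_w0_U_bottom by blast
  have "?y = ?z"
  proof (rule twist_top_injective[OF y(2) z(2)])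
    fix c assume c: "c \<in> carrier (residue_field v)"
    \<comment> \<open>the zeroth digit is \<open>c\<close>, so \<open>A 2 \<xi>\<close> lifts the residue class \<open>c\<close>\<close>
    define \<xi> where "\<xi> = restrict (\<lambda>_. c) {..<2::nat}"
    have \<xi>: "\<xi> \<in> residue_tuples 2" using c by (simp add: \<xi>_def residue_tuples_def)
    let ?M = "mat2 0 1 (- 1) (A 2 \<xi>)"
    have "\<tau> (std_fun (mat 1) ?y) = \<tau> (std_fun (mat 1) ?z)"
      using eq by (simp flip: y(1) z(1))
    then have "\<sigma> (mat 1) (\<sigma> w0 (U (\<sigma> ?M ?y))) bottom_index
        = \<sigma> (mat 1) (\<sigma> w0 (U (\<sigma> ?M ?z))) bottom_index"
      by (simp only: hecke_value_at_test_point[OF \<tau> y(2) \<xi>, symmetric]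
          hecke_value_at_test_point[OF \<tau> z(2) \<xi>, symmetric])
    then have "\<sigma> ?M ?y top_index = \<sigma> ?M ?z top_index"
      using b by (simp add: \<sigma>_one_apply bottom_index_mem)
    then show "\<exists>a\<in>val_ring v. reduction a = \<iota> c
        \<and> \<sigma> (mat2 0 1 (- 1) a) ?y top_index = \<sigma> (mat2 0 1 (- 1) a) ?z top_index"
      using A_in_val_ring[OF \<xi>] reduction_A_2[OF \<xi>] by (auto simp: \<xi>_def)
  qed
  then show "f = h" by (subst y(1), subst z(1)) simp
qed

end

theorem lemma4p5:
  fixes v :: "'a::field \<Rightarrow> int" and \<pi> :: 'a and \<iota> :: "'a set \<Rightarrow> 'k::field"
    and p e :: nat and r :: "nat \<Rightarrow> nat"
    and \<tau> :: "('a^2^2 \<Rightarrow> (nat \<Rightarrow> nat) \<Rightarrow> 'k) \<Rightarrow> ('a^2^2 \<Rightarrow> (nat \<Rightarrow> nat) \<Rightarrow> 'k)"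
  assumes "sl2_weight v \<pi> \<iota> p e r"
    and "sl2_weight.hecke_operator v \<pi> \<iota> p e r \<tau>"
  shows "\<tau> ` sl2_weight.C0 v \<pi> \<iota> p e r \<subseteq> sl2_weight.C1 v \<pi> \<iota> p e r
    \<and> inj_on \<tau> (sl2_weight.C0 v \<pi> \<iota> p e r)"
proof -
  interpret sl2_weight v \<pi> \<iota> p e r by (rule assms(1))
  show ?thesis
    using hecke_image_in_C1[OF assms(2)] hecke_injective_on_C0[OF assms(2)] by blast
qed

end
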